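(* For every fixed integer $r\geq 3$, we have $M^r_{r+1}(n)=\Theta(n^r)$, where $M^r_{r+1}(n)$ denotes the maximum running time of the $K^{(r)}_{r+1}$-bootstrap percolation process over all $r$-uniform hypergraphs $G_0$ on vertex set $[n]$ (the implicit constants depending only on $r$).
   Context: For an $r$-uniform hypergraph $H$ and an $r$-uniform hypergraph $G_0$ on vertex set $[n]=\{1,\dots,n\}$, the $H$-bootstrap percolation process is defined as follows: for each $t\geq 1$, $G_t$ is the $r$-uniform hypergraph on $[n]$ whose edge set consists of $E(G_{t-1})$ together with every $e\in\binom{[n]}{r}$ for which there exists a copy $H'$ of $H$ in $K^{(r)}_n$ with $E(H')\not\subseteq E(G_{t-1})$ and $E(H')\subseteq E(G_{t-1})\cup\{e\}$. The running time of the process on $G_0$ is $M_H(G_0)=\min\{t: G_t=G_{t+1}\}$, and $M_H(n)$ is the maximum of $M_H(G_0)$ over all $r$-uniform hypergraphs $G_0$ on $n$ vertices. $K^{(r)}_{k}$ denotes the complete $r$-uniform hypergraph on $k$ vertices, and $M^r_k(n)=M_{K^{(r)}_k}(n)$. *)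

theory Defs
  imports Complex_Main "HOL-Library.Ramsey" "HOL-Library.Landau_Symbols"
begin

text \<open>A hypergraph is a pair of vertex set and edge set. A hypergraph on the fixed vertex set
  \<open>{1..n}\<close> is given by its edge set alone; the complete \<open>r\<close>-uniform one is \<open>[{1..n}]\<^bsup>r\<^esup>\<close>.\<close>

type_synonym 'a hypergraph = "'a set \<times> 'a set set"

definition complete_hypergraph :: "nat \<Rightarrow> nat \<Rightarrow> nat hypergraph" where
  "complete_hypergraph r k = ({1..k}, [{1..k}]\<^bsup>r\<^esup>)"

definition copies :: "'a hypergraph \<Rightarrow> nat \<Rightarrow> nat hypergraph set" where
  "copies H n = {(f ` fst H, (`) f ` snd H) | f. inj_on f (fst H) \<and> f ` fst H \<subseteq> {1..n}}"

definition bootstrap_step ::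
    "nat \<Rightarrow> 'a hypergraph \<Rightarrow> nat \<Rightarrow> nat set set \<Rightarrow> nat set set" where
  "bootstrap_step r H n G =
     G \<union> {e \<in> [{1..n}]\<^bsup>r\<^esup>. \<exists>H' \<in> copies H n. \<not> snd H' \<subseteq> G \<and> snd H' \<subseteq> G \<union> {e}}"

definition bootstrap_process ::
    "nat \<Rightarrow> 'a hypergraph \<Rightarrow> nat \<Rightarrow> nat set set \<Rightarrow> nat \<Rightarrow> nat set set" where
  "bootstrap_process r H n G\<^sub>0 t = (bootstrap_step r H n ^^ t) G\<^sub>0"

text \<open>The process is increasing inside a finite set, so the least \<open>t\<close> below exists; the maximum
  in \<open>max_running_time\<close> ranges over a finite nonempty set.\<close>

definition running_time :: "nat \<Rightarrow> 'a hypergraph \<Rightarrow> nat \<Rightarrow> nat set set \<Rightarrow> nat" where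
  "running_time r H n G\<^sub>0 =
     (LEAST t. bootstrap_process r H n G\<^sub>0 t = bootstrap_process r H n G\<^sub>0 (t + 1))"

definition max_running_time :: "nat \<Rightarrow> 'a hypergraph \<Rightarrow> nat \<Rightarrow> nat" where
  "max_running_time r H n = Max (running_time r H n ` Pow ([{1..n}]\<^bsup>r\<^esup>))"

definition clique_running_time :: "nat \<Rightarrow> nat \<Rightarrow> nat \<Rightarrow> nat" where
  "clique_running_time r k n = max_running_time r (complete_hypergraph r k) n"

end

theory Submission
  imports Defs
begin

text \<open>The upper bound holds because every step before stabilisation adds an edge. For the lower bound
  we build, by induction on \<open>r\<close>, a chain of \<open>r\<close>-sets \<open>e 0, e 1, \<dots>\<close> that get infected one after the
  other: \<open>e t \<union> e (t + 1)\<close> is an \<open>(r + 1)\<close>-set all of whose other faces are initially infected, and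
  every other \<open>(r + 1)\<close>-set keeps at least two healthy faces forever. To pass from \<open>r\<close> to \<open>r + 1\<close> take
  new vertices \<open>a\<^sub>0, w\<^sub>0, a\<^sub>1, w\<^sub>1, \<dots>, a\<^sub>K\<^sub>-\<^sub>1, w\<^sub>K\<^sub>-\<^sub>1\<close>: join \<open>a\<^sub>0\<close> to the whole chain, move from \<open>a\<^sub>0\<close>
  via \<open>w\<^sub>0\<close> to \<open>a\<^sub>1\<close> at the end of the chain, traverse the chain backwards with \<open>a\<^sub>1\<close>, and so on. The
  intermediate vertices \<open>w\<^sub>k\<close> see only one edge of the chain, which prevents shortcuts between
  consecutive traversals. This multiplies the length by \<open>K\<close> at the cost of \<open>2 K\<close> vertices.\<close>

text \<open>\<open>F\<close> consists of the chain \<open>e\<close> and the initially infected sets, \<open>Q\<close> of the cliques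
  \<open>e t \<union> e (t + 1)\<close>. The counts of missing faces grow with \<open>r\<close>; this lets the induction start from the
  trivial chain at \<open>r = 0\<close>, although one-by-one infection is only guaranteed from \<open>r = 3\<close> on.\<close>

locale slow_chain =
  fixes r b N :: nat and F Q :: "nat set set" and e :: "nat \<Rightarrow> nat set"
  assumes N_pos: "0 < N"
    and F_sub: "f \<in> F \<Longrightarrow> f \<subseteq> {1..b}" and F_card: "f \<in> F \<Longrightarrow> card f = r"
    and Q_sub: "S \<in> Q \<Longrightarrow> S \<subseteq> {1..b}" and Q_card: "S \<in> Q \<Longrightarrow> card S = Suc r"
    and e_F: "t < N \<Longrightarrow> e t \<in> F"
    and e_inj: "inj_on e {..<N}"
    and Q_faces: "S \<in> Q \<Longrightarrow> v \<in> S \<Longrightarrow> S - {v} \<in> F"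
    and Q_link: "Suc t < N \<Longrightarrow> e t \<union> e (Suc t) \<in> Q"
    and Q_unique: "S \<in> Q \<Longrightarrow> \<exists>t. Suc t < N \<and> {s. s < N \<and> e s \<subseteq> S} = {t, Suc t}"
    and faces_missing: "S \<subseteq> {1..b} \<Longrightarrow> card S = Suc r \<Longrightarrow> S \<notin> Q \<Longrightarrow>
      r \<le> Suc (card {v \<in> S. S - {v} \<notin> F})"
    and cells_missing: "S \<subseteq> {1..b} \<Longrightarrow> card S = r + 2 \<Longrightarrow> r \<le> card {v \<in> S. S - {v} \<notin> Q}"

text \<open>One chain edge and no cliques make the link and uniqueness conditions vacuous; at
  \<open>r = 0\<close> both counting bounds are trivial.\<close>

lemma slow_chain_0: "slow_chain 0 0 1 {{}} {} (\<lambda>_. {})"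
  by unfold_locales (auto simp: inj_on_def)

section \<open>Extending a chain to the next uniformity\<close>

text \<open>Applied with \<open>B\<close> a pivot: deleting from \<open>A\<close> any vertex other
  than \<open>x\<close> leaves a set that still contains \<open>x\<close> and so is not the pivot or
  a part of it.\<close>

lemma not_subset_if_card_ge:
  assumes "finite B" "card B \<le> card A" "A \<noteq> B"
  obtains x where "x \<in> A" "x \<notin> B"
  using assms card_seteq by blast

context slow_chain
begin

text \<open>\<open>fresh (2 * k)\<close> and \<open>fresh (2 * k + 1)\<close> are the vertices \<open>a\<^sub>k\<close> and \<open>w\<^sub>k\<close>; the two pairs
  containing \<open>w\<^sub>k\<close> share the same edge \<open>pivot (2 * k) = pivot (2 * k + 1)\<close> of the old chain.\<close>

definition fresh :: "nat \<Rightarrow> nat" where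
  "fresh i = Suc (b + i)"

text \<open>Odd traversals run the old chain backwards, so each starts at the old edge where the
  previous one ended.\<close>

definition dir :: "nat \<Rightarrow> nat \<Rightarrow> nat" where
  "dir k j = (if even k then j else N - 1 - j)"

definition pivot :: "nat \<Rightarrow> nat set" where
  "pivot i = e (dir (i div 2) (N - 1))"

text \<open>Time is cut into blocks of length \<open>Suc N\<close>: \<open>N\<close> steps along the
  old chain with \<open>fresh (2 * k)\<close>, then one turning edge through
  \<open>fresh (Suc (2 * k))\<close>. The final block keeps its turning edge, so \<open>K\<close>
  blocks have total length \<open>tick K 0\<close>.\<close>

definition e' :: "nat \<Rightarrow> nat set" where
  "e' t = (let k = t div Suc N; j = t mod Suc N in
     if j < N then insert (fresh (2 * k)) (e (dir k j)) else insert (fresh (Suc (2 * k))) (pivot (2 * k)))"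

definition tick :: "nat \<Rightarrow> nat \<Rightarrow> nat" where
  "tick k j = k * Suc N + j"

lemma Suc_tick: "Suc (tick k j) = tick k (Suc j)"
  by (simp add: tick_def)

lemma Suc_tick_N: "Suc (tick k N) = tick (Suc k) 0"
  by (simp add: tick_def)

lemma tick_div: "j \<le> N \<Longrightarrow> tick k j div Suc N = k"
  unfolding tick_def by (subst div_mult_self3) (simp_all del: mult_Suc_right)

lemma tick_mod: "j \<le> N \<Longrightarrow> tick k j mod Suc N = j"
  unfolding tick_def by (subst mod_mult_self3) (simp_all del: mult_Suc_right)

lemma dir_less: "j < N \<Longrightarrow> dir k j < N"
  by (auto simp: dir_def)

lemma dir_inj: "i < N \<Longrightarrow> j < N \<Longrightarrow> dir k i = dir k j \<longleftrightarrow> i = j"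
  by (auto simp: dir_def)

lemma pivot_F: "pivot i \<in> F"
  unfolding pivot_def by (intro e_F dir_less) (use N_pos in auto)

lemma pivot_sub: "pivot i \<subseteq> {1..b}" and pivot_card: "card (pivot i) = r"
  using pivot_F F_sub F_card by auto

lemma pivot_finite: "finite (pivot i)"
  using pivot_sub finite_subset by blast

lemma pivot_even_Suc: "even i \<Longrightarrow> pivot (Suc i) = pivot i"
  by (auto simp: pivot_def)

lemma fresh_inj [simp]: "fresh i = fresh j \<longleftrightarrow> i = j"
  by (auto simp: fresh_def)

lemma fresh_notin: "X \<subseteq> {1..b} \<Longrightarrow> fresh i \<notin> X"
  by (auto simp: fresh_def)

lemma fresh_notin_simps [simp]: "fresh i \<notin> pivot j" "f \<in> F \<Longrightarrow> fresh i \<notin> f" "q \<in> Q \<Longrightarrow> fresh i \<notin> q"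
  by (simp_all only: fresh_notin pivot_sub F_sub Q_sub not_False_eq_True)

lemma insert_fresh_eq:
  "X \<subseteq> {1..b} \<Longrightarrow> Y \<subseteq> {1..b} \<Longrightarrow> insert (fresh i) X = insert (fresh j) Y \<longleftrightarrow> i = j \<and> X = Y"
  using fresh_notin[of X] fresh_notin[of Y] by (metis insertE insertI1 insert_ident fresh_inj)

context
  fixes K :: nat
  assumes K_pos: "0 < K"
begin

text \<open>The last two families supply faces of \<open>Q'\<close>: deleting \<open>fresh i\<close>
  from \<open>insert (fresh i) q\<close> leaves the old clique \<open>q\<close>, and deleting an old
  vertex from a turning clique leaves two fresh vertices with a punctured pivot.\<close>

definition F' :: "nat set set" where
  "F' = {insert (fresh i) f | i f. i < 2 * K \<and> even i \<and> f \<in> F} \<union>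
        {insert (fresh i) (pivot i) | i. i < 2 * K \<and> odd i} \<union> Q \<union>
        {{fresh i, fresh (Suc i)} \<union> (pivot i - {v}) | i v. Suc i < 2 * K \<and> v \<in> pivot i}"

text \<open>The first family moves along a traversal. In the second, even \<open>i\<close> leads
  from a traversal to its turning edge and odd \<open>i\<close> from there into the next
  traversal.\<close>

definition Q' :: "nat set set" where
  "Q' = {insert (fresh i) q | i q. i < 2 * K \<and> even i \<and> q \<in> Q} \<union>
        {{fresh i, fresh (Suc i)} \<union> pivot i | i. Suc i < 2 * K}"

section \<open>Membership in \<open>F'\<close> and \<open>Q'\<close>, by the number of fresh
  vertices\<close>

lemma F'_iff_old:
  assumes "X \<subseteq> {1..b}"
  shows "X \<in> F' \<longleftrightarrow> X \<in> Q"
  using fresh_notin[OF assms] by (auto simp: F'_def)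

lemma F'_iff_one:
  assumes "X \<subseteq> {1..b}" "i < 2 * K"
  shows "insert (fresh i) X \<in> F' \<longleftrightarrow> (if even i then X \<in> F else X = pivot i)"
proof -
  have "insert (fresh i) X \<notin> Q"
    using fresh_notin_simps(3) by blast
  moreover have "insert (fresh i) X \<noteq> {fresh j, fresh (Suc j)} \<union> (pivot j - {v})" for j v
  proof
    assume "insert (fresh i) X = {fresh j, fresh (Suc j)} \<union> (pivot j - {v})"
    then have "fresh j \<in> insert (fresh i) X" "fresh (Suc j) \<in> insert (fresh i) X"
      by auto
    then show False
      using fresh_notin[OF assms(1)] by auto
  qed
  moreover have "insert (fresh i) X = insert (fresh j) f \<longleftrightarrow> i = j \<and> X = f" if "f \<in> F" for j f
    using insert_fresh_eq[OF assms(1) F_sub[OF that]] .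
  ultimately show ?thesis
    using assms(2) pivot_F[of i] pivot_F unfolding F'_def by (smt (verit, ccfv_threshold) Un_iff mem_Collect_eq)
qed

text \<open>Only the last family of \<open>F'\<close> has sets with two fresh vertices; the pair
  fixes the index, and removing it leaves the punctured pivot.\<close>

lemma F'_iff_two:
  assumes "X \<subseteq> {1..b}" "Suc i < 2 * K"
  shows "{fresh i, fresh (Suc i)} \<union> X \<in> F' \<longleftrightarrow> (\<exists>v \<in> pivot i. X = pivot i - {v})"
proof
  assume "{fresh i, fresh (Suc i)} \<union> X \<in> F'"
  then consider j f where "{fresh i, fresh (Suc i)} \<union> X = insert (fresh j) f" "f \<in> F"
    | "{fresh i, fresh (Suc i)} \<union> X \<in> Q"
    | j v where "{fresh i, fresh (Suc i)} \<union> X = {fresh j, fresh (Suc j)} \<union> (pivot j - {v})" "v \<in> pivot j"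
    using pivot_F unfolding F'_def by blast
  then show "\<exists>v \<in> pivot i. X = pivot i - {v}"
  proof cases
    case 1
    then have "fresh i \<in> insert (fresh j) f" "fresh (Suc i) \<in> insert (fresh j) f"
      by blast+
    then show ?thesis using 1(2) by auto
  next
    case 2
    then show ?thesis
      using fresh_notin_simps(3) by blast
  next
    case 3
    have "fresh i \<in> {fresh j, fresh (Suc j)} \<union> (pivot j - {v})" "fresh (Suc i) \<in> {fresh j, fresh (Suc j)} \<union> (pivot j - {v})"
      using 3(1) by blast+
    then have "i = j"
      by auto
    have "X = ({fresh i, fresh (Suc i)} \<union> X) - {fresh i, fresh (Suc i)}"
      using fresh_notin[OF assms(1)] by auto
    also have "\<dots> = ({fresh j, fresh (Suc j)} \<union> (pivot j - {v})) - {fresh j, fresh (Suc j)}"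
      unfolding 3(1) by (simp only: \<open>i = j\<close>)
    also have "\<dots> = pivot i - {v}"
      using \<open>i = j\<close> by auto
    finally show ?thesis
      using 3(2) \<open>i = j\<close> by blast
  qed
next
  assume "\<exists>v \<in> pivot i. X = pivot i - {v}"
  then show "{fresh i, fresh (Suc i)} \<union> X \<in> F'"
    using assms(2) unfolding F'_def by blast
qed

lemma F'_fresh_close: "X \<in> F' \<Longrightarrow> fresh i \<in> X \<Longrightarrow> fresh j \<in> X \<Longrightarrow> j \<le> Suc i"
  by (auto simp: F'_def)

lemma Q'_no_old:
  assumes "X \<subseteq> {1..b}"
  shows "X \<notin> Q'"
  using fresh_notin[OF assms] by (auto simp: Q'_def)

lemma Q'_iff_one:
  assumes "X \<subseteq> {1..b}" "i < 2 * K"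
  shows "insert (fresh i) X \<in> Q' \<longleftrightarrow> even i \<and> X \<in> Q"
proof -
  have "insert (fresh i) X \<noteq> {fresh j, fresh (Suc j)} \<union> pivot j" for j
  proof
    assume "insert (fresh i) X = {fresh j, fresh (Suc j)} \<union> pivot j"
    then have "fresh j \<in> insert (fresh i) X" "fresh (Suc j) \<in> insert (fresh i) X"
      by auto
    then show False
      using fresh_notin[OF assms(1)] by auto
  qed
  moreover have "insert (fresh i) X = insert (fresh j) q \<longleftrightarrow> i = j \<and> X = q" if "q \<in> Q" for j q
    using insert_fresh_eq[OF assms(1) Q_sub[OF that]] .
  ultimately show ?thesis
    using assms(2) unfolding Q'_def Un_iff mem_Collect_eq by metis
qed

lemma Q'_iff_two:
  assumes "X \<subseteq> {1..b}" "Suc i < 2 * K"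
  shows "{fresh i, fresh (Suc i)} \<union> X \<in> Q' \<longleftrightarrow> X = pivot i"
proof
  assume "{fresh i, fresh (Suc i)} \<union> X \<in> Q'"
  then consider j q where "{fresh i, fresh (Suc i)} \<union> X = insert (fresh j) q" "q \<in> Q"
    | j where "{fresh i, fresh (Suc i)} \<union> X = {fresh j, fresh (Suc j)} \<union> pivot j"
    unfolding Q'_def by blast
  then show "X = pivot i"
  proof cases
    case 1
    then have "fresh i \<in> insert (fresh j) q" "fresh (Suc i) \<in> insert (fresh j) q"
      by blast+
    then show ?thesis using 1(2) by auto
  next
    case 2
    have "fresh i \<in> {fresh j, fresh (Suc j)} \<union> pivot j" "fresh (Suc i) \<in> {fresh j, fresh (Suc j)} \<union> pivot j"
      using 2 by blast+
    then have "i = j"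
      by auto
    have "X = ({fresh i, fresh (Suc i)} \<union> X) - {fresh i, fresh (Suc i)}"
      using fresh_notin[OF assms(1)] by auto
    also have "\<dots> = ({fresh j, fresh (Suc j)} \<union> pivot j) - {fresh j, fresh (Suc j)}"
      unfolding 2 by (simp only: \<open>i = j\<close>)
    also have "\<dots> = pivot i"
      using \<open>i = j\<close> by auto
    finally show ?thesis .
  qed
next
  assume "X = pivot i"
  then show "{fresh i, fresh (Suc i)} \<union> X \<in> Q'"
    using assms(2) unfolding Q'_def by blast
qed

lemma Q'_fresh_close: "X \<in> Q' \<Longrightarrow> fresh i \<in> X \<Longrightarrow> fresh j \<in> X \<Longrightarrow> j \<le> Suc i"
  by (auto simp: Q'_def)

text \<open>If no two fresh indices of \<open>S\<close> differ by more than one, all lie in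
  \<open>{i, Suc i}\<close> for the least one \<open>i\<close>. The case \<open>far\<close> is
  harmless: by \<open>F'_fresh_close\<close> and \<open>Q'_fresh_close\<close>, no face retaining
  both far vertices is in \<open>F'\<close> or \<open>Q'\<close>.\<close>

lemma extended_set_cases:
  assumes "S \<subseteq> {1..b + 2 * K}"
  obtains (old) "S \<subseteq> {1..b}"
    | (one) i X where "i < 2 * K" "X \<subseteq> {1..b}" "S = insert (fresh i) X" "fresh i \<notin> X"
    | (two) i X where "Suc i < 2 * K" "X \<subseteq> {1..b}" "S = {fresh i, fresh (Suc i)} \<union> X"
        "fresh i \<notin> X" "fresh (Suc i) \<notin> X"
    | (far) i j where "fresh i \<in> S" "fresh j \<in> S" "Suc i < j"
proof -
  define X where "X = S \<inter> {1..b}"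
  define I where "I = {i. fresh i \<in> S}"
  have X: "X \<subseteq> {1..b}" "\<And>i. fresh i \<notin> X"
    using fresh_notin[of X] by (auto simp: X_def)
  have I_less: "i < 2 * K" if "i \<in> I" for i
    using that assms by (auto simp: I_def fresh_def)
  have S: "S = fresh ` I \<union> X"
  proof
    show "S \<subseteq> fresh ` I \<union> X"
    proof
      fix x assume x: "x \<in> S"
      show "x \<in> fresh ` I \<union> X"
      proof (cases "x \<le> b")
        case True
        then show ?thesis using x assms by (auto simp: X_def)
      next
        case False
        then have "x = fresh (x - Suc b)"
          by (simp add: fresh_def)
        then show ?thesis
          using x by (metis I_def UnI1 imageI mem_Collect_eq)
      qed
    qed
  qed (auto simp: I_def X_def)
  show thesis
  proof (cases "\<exists>i \<in> I. \<exists>j \<in> I. Suc i < j")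
    case True
    then show thesis using far by (auto simp: I_def)
  next
    case False
    show thesis
    proof (cases "I = {}")
      case True
      then show thesis using old S X by simp
    next
      case ne: False
      define i where "i = (LEAST i. i \<in> I)"
      have i: "i \<in> I" "\<And>j. j \<in> I \<Longrightarrow> i \<le> j"
        using ne by (auto simp: i_def intro: LeastI Least_le)
      have "j = i \<or> j = Suc i" if "j \<in> I" for j
        using that i False by (metis le_antisym not_less_eq_eq not_le)
      then consider "I = {i}" | "I = {i, Suc i}"
        using i(1) by blast
      then show thesis
      proof cases
        case 1
        then show thesis using one[of i X] S X I_less by simp
      next
        case 2
        then show thesis using two[of i X] S X I_less by simp
      qed
    qed
  qed
qed

section \<open>Missing faces and cliques in the extension\<close>

lemma faces_missing':
  assumes S: "S \<subseteq> {1..b + 2 * K}" "card S = Suc (Suc r)" "S \<notin> Q'"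
  shows "Suc r \<le> Suc (card {v \<in> S. S - {v} \<notin> F'})"
proof -
  let ?M = "{v \<in> S. S - {v} \<notin> F'}"
  have fin: "finite S"
    using S(1) finite_subset by blast
  then have finM: "finite ?M" by simp
  have "r \<le> card ?M"
    using S(1)
  proof (cases rule: extended_set_cases)
    case old
    \<comment> \<open>Old faces of size \<open>Suc r\<close> are present exactly when they are
      cliques of \<open>Q\<close>; for this case \<open>cells_missing\<close> is carried through the
      induction.\<close>
    then have "S - {v} \<in> F' \<longleftrightarrow> S - {v} \<in> Q" for v
      by (intro F'_iff_old) auto
    then show ?thesis
      using cells_missing[OF old] S(2) by simp
  next
    case (one i X)
    have cX: "card X = Suc r" "finite X"
      using one fin S(2) by auto
    have sub: "X - {v} \<subseteq> {1..b}" for v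
      using one(2) by blast
    have *: "S - {v} \<in> F' \<longleftrightarrow> (if even i then X - {v} \<in> F else X - {v} = pivot i)" if "v \<in> X" for v
    proof -
      have "S - {v} = insert (fresh i) (X - {v})"
        using one that by auto
      then show ?thesis using F'_iff_one[OF sub one(1)] by simp
    qed
    show ?thesis
    proof (cases "even i")
      case True
      have "X \<notin> Q"
        using S(3) one(3) Q'_iff_one[OF one(2,1)] True by simp
      moreover have "S - {fresh i} = X"
        using one by auto
      ultimately have "fresh i \<in> ?M"
        using F'_iff_old[OF one(2)] one(3) by simp
      \<comment> \<open>The missing face \<open>X\<close> makes up for the one that
        \<open>faces_missing\<close> concedes for \<open>X\<close>.\<close>
      then have "insert (fresh i) {v \<in> X. X - {v} \<notin> F} \<subseteq> ?M"
        using * True one by auto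
      then have "card (insert (fresh i) {v \<in> X. X - {v} \<notin> F}) \<le> card ?M"
        by (rule card_mono[OF finM])
      then show ?thesis
        using faces_missing[OF one(2) cX(1) \<open>X \<notin> Q\<close>] one cX by simp
    next
      case False
      \<comment> \<open>A turning vertex sees only its pivot, so every face keeping both it and
        \<open>x\<close> is missing.\<close>
      have "X \<noteq> pivot i"
        using cX pivot_card[of i] by auto
      then obtain x where x: "x \<in> X" "x \<notin> pivot i"
        using not_subset_if_card_ge[OF pivot_finite, of i X] cX pivot_card[of i] by auto
      have "X - {x} \<subseteq> ?M"
      proof
        fix v assume v: "v \<in> X - {x}"
        then have "X - {v} \<noteq> pivot i" using x by blast
        then show "v \<in> ?M" using * v False one by auto
      qed
      then have "card (X - {x}) \<le> card ?M"
        by (rule card_mono[OF finM])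
      then show ?thesis using cX x by simp
    qed
  next
    case (two i X)
    have cX: "card X = r" "finite X"
      using two fin S(2) by auto
    have sub: "X - {v} \<subseteq> {1..b}" for v
      using two(2) by blast
    have "X \<noteq> pivot i"
      using S(3) two(3) Q'_iff_two[OF two(2,1)] by simp
    \<comment> \<open>Deleting \<open>a\<close> leaves the turning vertex as the only fresh one; it
      sees only the pivot, and \<open>X\<close> differs from that.\<close>
    define a where "a = (if even i then fresh i else fresh (Suc i))"
    have "S - {a} \<notin> F'"
    proof (cases "even i")
      case True
      then have "S - {a} = insert (fresh (Suc i)) X"
        using two by (auto simp: a_def)
      then show ?thesis
        using F'_iff_one[of X "Suc i"] two True \<open>X \<noteq> pivot i\<close> pivot_even_Suc by simp
    next
      case False
      then have "S - {a} = insert (fresh i) X"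
        using two by (auto simp: a_def)
      then show ?thesis
        using F'_iff_one[of X i] two False \<open>X \<noteq> pivot i\<close> by simp
    qed
    then have a: "a \<in> ?M" "a \<notin> X"
      using two by (auto simp: a_def)
    obtain x where x: "x \<in> X" "x \<notin> pivot i"
      using not_subset_if_card_ge[OF pivot_finite, of i X] cX pivot_card \<open>X \<noteq> pivot i\<close> by auto
    have "insert a (X - {x}) \<subseteq> ?M"
    proof -
      have "v \<in> ?M" if v: "v \<in> X - {x}" for v
      proof -
        have "S - {v} = {fresh i, fresh (Suc i)} \<union> (X - {v})"
          using two v by auto
        moreover have "\<not> (\<exists>w \<in> pivot i. X - {v} = pivot i - {w})"
          using x v by blast
        ultimately have "S - {v} \<notin> F'"
          using F'_iff_two[OF sub two(1)] by simp
        then show ?thesis using v two by auto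
      qed
      then show ?thesis using a by auto
    qed
    then have "card (insert a (X - {x})) \<le> card ?M"
      by (rule card_mono[OF finM])
    moreover have "card (insert a (X - {x})) = r"
      using cX x a card_Suc_Diff1[of X x] by simp
    ultimately show ?thesis by simp
  next
    case (far i j)
    have "S - {v} \<notin> F'" if "v \<in> S - {fresh i, fresh j}" for v
      using F'_fresh_close[of "S - {v}" i j] far that by auto
    then have "S - {fresh i, fresh j} \<subseteq> ?M" by blast
    then have "card (S - {fresh i, fresh j}) \<le> card ?M"
      by (rule card_mono[OF finM])
    then show ?thesis
      using far S(2) by (simp add: card_Diff_subset)
  qed
  then show ?thesis by simp
qed

text \<open>Same cases as for \<open>faces_missing'\<close>. With one fresh vertex, deleting it
  leaves an old set, which \<open>Q'\<close> never contains; this is the extra unit over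
  \<open>cells_missing\<close> for \<open>X\<close>.\<close>

lemma cells_missing':
  assumes S: "S \<subseteq> {1..b + 2 * K}" "card S = Suc r + 2"
  shows "Suc r \<le> card {v \<in> S. S - {v} \<notin> Q'}"
proof -
  let ?M = "{v \<in> S. S - {v} \<notin> Q'}"
  have fin: "finite S"
    using S(1) finite_subset by blast
  then have finM: "finite ?M" by simp
  show ?thesis
    using S(1)
  proof (cases rule: extended_set_cases)
    case old
    then have "S - {v} \<notin> Q'" for v
      by (intro Q'_no_old) auto
    then show ?thesis using S(2) by simp
  next
    case (one i X)
    have cX: "card X = r + 2" "finite X"
      using one fin S(2) by auto
    have sub: "X - {v} \<subseteq> {1..b}" for v
      using one(2) by blast
    have "S - {fresh i} = X"
      using one by auto
    then have "fresh i \<in> ?M"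
      using Q'_no_old[OF one(2)] one(3) by simp
    moreover have "S - {v} \<notin> Q'" if "v \<in> X" "X - {v} \<notin> Q" for v
    proof -
      have "S - {v} = insert (fresh i) (X - {v})"
        using one that by auto
      then show ?thesis using Q'_iff_one[OF sub one(1)] that by simp
    qed
    ultimately have "insert (fresh i) {v \<in> X. X - {v} \<notin> Q} \<subseteq> ?M"
      using one by auto
    then have "card (insert (fresh i) {v \<in> X. X - {v} \<notin> Q}) \<le> card ?M"
      by (rule card_mono[OF finM])
    then show ?thesis
      using cells_missing[OF one(2) cX(1)] one cX by simp
  next
    case (two i X)
    have cX: "card X = Suc r" "finite X"
      using two fin S(2) by auto
    have sub: "X - {v} \<subseteq> {1..b}" for v
      using two(2) by blast
    \<comment> \<open>Deleting \<open>a\<close> leaves a turning vertex as the only fresh one, and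
      \<open>Q'\<close> has no such set.\<close>
    define a where "a = (if even i then fresh i else fresh (Suc i))"
    have "S - {a} \<notin> Q'"
    proof (cases "even i")
      case True
      then have "S - {a} = insert (fresh (Suc i)) X"
        using two by (auto simp: a_def)
      then show ?thesis
        using Q'_iff_one[of X "Suc i"] two True by simp
    next
      case False
      then have "S - {a} = insert (fresh i) X"
        using two by (auto simp: a_def)
      then show ?thesis
        using Q'_iff_one[of X i] two False by simp
    qed
    then have a: "a \<in> ?M" "a \<notin> X"
      using two by (auto simp: a_def)
    have "X \<noteq> pivot i"
      using cX pivot_card[of i] by auto
    then obtain x where x: "x \<in> X" "x \<notin> pivot i"
      using not_subset_if_card_ge[OF pivot_finite, of i X] cX pivot_card[of i] by auto
    have "insert a (X - {x}) \<subseteq> ?M"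
    proof -
      have "v \<in> ?M" if v: "v \<in> X - {x}" for v
      proof -
        have "S - {v} = {fresh i, fresh (Suc i)} \<union> (X - {v})"
          using two v by auto
        moreover have "X - {v} \<noteq> pivot i"
          using x v by blast
        ultimately have "S - {v} \<notin> Q'"
          using Q'_iff_two[OF sub two(1)] by simp
        then show ?thesis using v two by auto
      qed
      then show ?thesis using a by auto
    qed
    then have "card (insert a (X - {x})) \<le> card ?M"
      by (rule card_mono[OF finM])
    then show ?thesis
      using cX x a by simp
  next
    case (far i j)
    have "S - {v} \<notin> Q'" if "v \<in> S - {fresh i, fresh j}" for v
      using Q'_fresh_close[of "S - {v}" i j] far that by auto
    then have "S - {fresh i, fresh j} \<subseteq> ?M" by blast
    then have "card (S - {fresh i, fresh j}) \<le> card ?M"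
      by (rule card_mono[OF finM])
    then show ?thesis
      using far S(2) by (simp add: card_Diff_subset)
  qed
qed

section \<open>The extended chain and its cliques\<close>

lemma e'_traverse: "j < N \<Longrightarrow> e' (tick k j) = insert (fresh (2 * k)) (e (dir k j))"
  by (simp add: e'_def tick_div tick_mod)

lemma e'_turn: "e' (tick k N) = insert (fresh (Suc (2 * k))) (pivot (2 * k))"
  by (simp add: e'_def tick_div tick_mod)

lemma dir_Suc_0: "e (dir (Suc k) 0) = pivot (2 * k)"
  by (auto simp: dir_def pivot_def)

text \<open>Chain edges have equal size, so inclusion is equality, and injectivity of
  \<open>e\<close> and \<open>dir k\<close> leaves only the last position.\<close>

lemma e_dir_subset_pivot:
  assumes j: "j < N"
  shows "e (dir k j) \<subseteq> pivot (2 * k) \<longleftrightarrow> j = N - 1"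
proof -
  have "e (dir k j) \<subseteq> pivot (2 * k) \<longleftrightarrow> e (dir k j) = pivot (2 * k)"
    using card_subset_eq[OF pivot_finite, of "e (dir k j)" "2 * k"] pivot_card F_card[OF e_F[OF dir_less[OF j]]]
    by auto
  also have "\<dots> \<longleftrightarrow> dir k j = dir k (N - 1)"
    unfolding pivot_def using inj_on_eq_iff[OF e_inj] dir_less[OF j] dir_less[of "N - 1" k] N_pos by auto
  also have "\<dots> \<longleftrightarrow> j = N - 1"
    using dir_inj j N_pos by simp
  finally show ?thesis .
qed

lemma e_dir_Suc_subset_pivot:
  assumes j: "j < N"
  shows "e (dir (Suc k) j) \<subseteq> pivot (2 * k) \<longleftrightarrow> j = 0"
proof -
  \<comment> \<open>Consecutive traversals are mirror images, so the last position of one is the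
    first of the next.\<close>
  have "dir (Suc k) j = dir k (N - 1 - j)"
    using j by (auto simp: dir_def)
  then show ?thesis
    using e_dir_subset_pivot[of "N - 1 - j" k] j by auto
qed

lemma tick_cases:
  assumes "t < tick K 0"
  obtains (traverse) k j where "k < K" "j < N" "t = tick k j"
    | (turn) k where "k < K" "t = tick k N"
proof -
  have t: "t = tick (t div Suc N) (t mod Suc N)" "t mod Suc N < Suc N"
    by (simp_all only: tick_def div_mult_mod_eq mod_less_divisor zero_less_Suc)
  moreover have "t div Suc N < K"
    using assms by (simp add: tick_def less_mult_imp_div_less)
  ultimately show thesis
    using traverse turn by (metis less_Suc_eq)
qed

lemma tick_less:
  assumes "k < K" "j \<le> N" shows "tick k j < tick K 0"
proof -
  have "tick k j < Suc k * Suc N"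
    using assms(2) by (simp add: tick_def)
  also have "\<dots> \<le> K * Suc N"
    using assms(1) by (intro mult_le_mono1) simp
  finally show ?thesis by (simp add: tick_def)
qed

lemma e'_F':
  assumes "t < tick K 0" shows "e' t \<in> F'"
  using assms
proof (cases rule: tick_cases)
  case (traverse k j)
  have "e (dir k j) \<in> F"
    using e_F dir_less traverse by simp
  then show ?thesis
    using F'_iff_one[OF F_sub, of "e (dir k j)" "2 * k"] traverse by (simp add: e'_traverse)
next
  case (turn k)
  then show ?thesis
    using F'_iff_one[OF pivot_sub, of "Suc (2 * k)" "2 * k"] pivot_even_Suc[of "2 * k"] by (simp add: e'_turn)
qed

text \<open>Steps inside a traversal come from old links; steps into and out of a turning edge keep
  the pivot and only change the fresh vertex.\<close>

lemma Q'_link: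
  assumes "Suc t < tick K 0" shows "e' t \<union> e' (Suc t) \<in> Q'"
proof -
  have "t < tick K 0" using assms by simp
  then show ?thesis
  proof (cases rule: tick_cases)
    case (traverse k j)
    have Suc_t: "Suc t = tick k (Suc j)"
      using traverse Suc_tick by simp
    show ?thesis
    proof (cases "Suc j < N")
      case True
      have "e (dir k j) \<union> e (dir k (Suc j)) \<in> Q"
      proof (cases "even k")
        case True
        then show ?thesis using Q_link \<open>Suc j < N\<close> by (simp add: dir_def)
      next
        case False
        \<comment> \<open>Backwards, position \<open>Suc j\<close> is the earlier one in the old
          chain, so the old link starts there.\<close>
        have "Suc (N - 1 - Suc j) = N - 1 - j"
          using \<open>Suc j < N\<close> by simp
        then show ?thesis
          using Q_link[of "N - 1 - Suc j"] False \<open>Suc j < N\<close> by (simp add: dir_def Un_commute)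
      qed
      moreover have "e' t \<union> e' (Suc t) = insert (fresh (2 * k)) (e (dir k j) \<union> e (dir k (Suc j)))"
        unfolding Suc_t e'_traverse[OF True] unfolding traverse(3) e'_traverse[OF traverse(2)] by auto
      ultimately show ?thesis
        using Q'_iff_one[OF Q_sub, of "e (dir k j) \<union> e (dir k (Suc j))" "2 * k"] traverse(1) by simp
    next
      case False
      then have "Suc j = N" using traverse by simp
      then have "e (dir k j) = pivot (2 * k)"
        by (auto simp: pivot_def)
      then have "e' t \<union> e' (Suc t) = {fresh (2 * k), fresh (Suc (2 * k))} \<union> pivot (2 * k)"
        unfolding Suc_t \<open>Suc j = N\<close> e'_turn unfolding traverse(3) e'_traverse[OF traverse(2)] by auto
      then show ?thesis
        using Q'_iff_two[OF pivot_sub] traverse(1) by simp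
    qed
  next
    case (turn k)
    then have Suc_t: "Suc t = tick (Suc k) 0"
      using Suc_tick_N by simp
    \<comment> \<open>The turning edge of the final block ends the chain; having a successor
      excludes it.\<close>
    then have "Suc k < K"
      using assms unfolding tick_def by (metis add_0_right mult_less_cancel2)
    moreover have "e' t \<union> e' (Suc t) = {fresh (Suc (2 * k)), fresh (Suc (Suc (2 * k)))} \<union> pivot (2 * k)"
      unfolding Suc_t e'_traverse[OF N_pos] dir_Suc_0 unfolding turn(2) e'_turn by auto
    ultimately show ?thesis
      using Q'_iff_two[OF pivot_sub[of "2 * k"], of "Suc (2 * k)"] pivot_even_Suc[of "2 * k"] by simp
  qed
qed

text \<open>Turning vertices have odd index, so no turning edge fits, and the fresh vertex fixes the
  traversal.\<close>

lemma e'_subset_iff_even: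
  assumes "j \<le> N" "X \<subseteq> {1..b}"
  shows "e' (tick k' j) \<subseteq> insert (fresh (2 * k)) X \<longleftrightarrow> j < N \<and> k' = k \<and> e (dir k j) \<subseteq> X"
proof (cases "j < N")
  case True
  then have "e (dir k' j) \<subseteq> {1..b}"
    using F_sub e_F dir_less by blast
  then have "fresh (2 * k) \<notin> e (dir k' j)"
    by (rule fresh_notin)
  moreover have "fresh (2 * k') \<in> insert (fresh (2 * k)) X \<longleftrightarrow> k' = k"
    using fresh_notin[OF assms(2)] by simp
  ultimately show ?thesis
    using True unfolding e'_traverse[OF True] by blast
next
  case False
  then have "j = N" using assms by simp
  moreover have "fresh (Suc (2 * k')) \<noteq> fresh (2 * k)"
    using fresh_inj by presburger
  ultimately show ?thesis
    using fresh_notin[OF assms(2), of "Suc (2 * k')"] by (auto simp: e'_turn)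
qed

lemma e'_subset_iff_two:
  assumes "j \<le> N"
  shows "e' (tick k' j) \<subseteq> {fresh i, fresh (Suc i)} \<union> pivot i \<longleftrightarrow>
    (j < N \<and> (2 * k' = i \<or> 2 * k' = Suc i) \<and> e (dir k' j) \<subseteq> pivot i) \<or>
    (j = N \<and> (Suc (2 * k') = i \<or> Suc (2 * k') = Suc i) \<and> pivot (2 * k') \<subseteq> pivot i)"
proof (cases "j < N")
  case True
  then have "e (dir k' j) \<subseteq> {1..b}"
    using F_sub e_F dir_less by blast
  then have "fresh l \<notin> e (dir k' j)" for l
    by (rule fresh_notin)
  then show ?thesis
    using True unfolding e'_traverse[OF True] by auto
next
  case False
  then have "j = N" using assms by simp
  then show ?thesis
    unfolding e'_turn \<open>j = N\<close> by auto
qed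

text \<open>A clique within a traversal inherits uniqueness from the old chain. A turning clique has
  only \<open>pivot i\<close> as its old part, which contains a single edge of the adjacent
  traversal; this rules out shortcuts between traversals.\<close>

lemma Q'_unique:
  assumes "S \<in> Q'"
  shows "\<exists>t. Suc t < tick K 0 \<and> {s. s < tick K 0 \<and> e' s \<subseteq> S} = {t, Suc t}"
proof -
  have *: "\<exists>t. Suc t < tick K 0 \<and> {s. s < tick K 0 \<and> e' s \<subseteq> S} = {t, Suc t}"
    if t: "Suc t < tick K 0" "e' t \<subseteq> S" "e' (Suc t) \<subseteq> S"
      and only: "\<And>k j. k < K \<Longrightarrow> j \<le> N \<Longrightarrow> e' (tick k j) \<subseteq> S \<Longrightarrow> tick k j = t \<or> tick k j = Suc t" for t
  proof -
    have "s = t \<or> s = Suc t" if "s < tick K 0" "e' s \<subseteq> S" for s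
      using that(1)
    proof (cases rule: tick_cases)
      case (traverse k j)
      then show ?thesis using only[of k j] that(2) by simp
    next
      case (turn k)
      then show ?thesis using only[of k N] that(2) by simp
    qed
    then have "{s. s < tick K 0 \<and> e' s \<subseteq> S} = {t, Suc t}"
      using t by auto
    then show ?thesis using t(1) by blast
  qed
  from assms consider i q where "S = insert (fresh i) q" "i < 2 * K" "even i" "q \<in> Q"
    | i where "S = {fresh i, fresh (Suc i)} \<union> pivot i" "Suc i < 2 * K"
    unfolding Q'_def by blast
  then show ?thesis
  proof cases
    case 1
    obtain k where k: "i = 2 * k" "k < K"
      using 1 by auto
    obtain t where t: "Suc t < N" "{s. s < N \<and> e s \<subseteq> q} = {t, Suc t}"
      using Q_unique 1 by blast
    \<comment> \<open>A backward traversal meets \<open>e (Suc t)\<close> before \<open>e t\<close>,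
      so it reaches this pair at the mirrored index of \<open>Suc t\<close>.\<close>
    define t' where "t' = (if even k then t else N - 1 - Suc t)"
    have t': "Suc t' < N" "{dir k t', dir k (Suc t')} = {t, Suc t}"
      using t(1) by (auto simp: t'_def dir_def)
    have sub: "e' (tick k' j) \<subseteq> S \<longleftrightarrow> j < N \<and> k' = k \<and> (j = t' \<or> j = Suc t')" if "j \<le> N" for k' j
    proof -
      have "e' (tick k' j) \<subseteq> S \<longleftrightarrow> j < N \<and> k' = k \<and> e (dir k j) \<subseteq> q"
        using e'_subset_iff_even[OF that Q_sub] 1 k by simp
      moreover have "e (dir k j) \<subseteq> q \<longleftrightarrow> j = t' \<or> j = Suc t'" if j: "j < N"
      proof -
        have "e (dir k j) \<subseteq> q \<longleftrightarrow> dir k j \<in> {t, Suc t}"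
          unfolding t(2)[symmetric] using dir_less[OF j] by simp
        also have "\<dots> \<longleftrightarrow> j = t' \<or> j = Suc t'"
          unfolding t'(2)[symmetric] using dir_inj j t'(1) by auto
        finally show ?thesis .
      qed
      ultimately show ?thesis by blast
    qed
    show ?thesis
    proof (rule *[of "tick k t'"])
      show "Suc (tick k t') < tick K 0"
        unfolding Suc_tick using tick_less[OF k(2)] t'(1) by simp
      show "e' (tick k t') \<subseteq> S" "e' (Suc (tick k t')) \<subseteq> S"
        unfolding Suc_tick using sub t'(1) by simp_all
      show "tick k' j = tick k t' \<or> tick k' j = Suc (tick k t')"
        if "k' < K" "j \<le> N" "e' (tick k' j) \<subseteq> S" for k' j
        unfolding Suc_tick using sub[OF that(2)] that(3) by auto
    qed
  next
    case 2
    define k where "k = i div 2"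
    have pivot_k: "pivot i = pivot (2 * k)"
      by (simp add: pivot_def k_def)
    have sub: "e' (tick k' j) \<subseteq> S \<longleftrightarrow>
      (j < N \<and> (2 * k' = i \<or> 2 * k' = Suc i) \<and> e (dir k' j) \<subseteq> pivot (2 * k)) \<or>
      (j = N \<and> (Suc (2 * k') = i \<or> Suc (2 * k') = Suc i) \<and> pivot (2 * k') \<subseteq> pivot (2 * k))"
      if "j \<le> N" for k' j
      using e'_subset_iff_two[OF that, of k' i] unfolding 2(1) pivot_k .
    show ?thesis
    proof (cases "even i")
      case True
      then have i: "i = 2 * k" "k < K"
        using 2 by (auto simp: k_def)
      have "Suc (N - 1) = N"
        using N_pos by simp
      have sub': "e' (tick k' j) \<subseteq> S \<longleftrightarrow> k' = k \<and> (j = N - 1 \<or> j = N)" if "j \<le> N" for k' j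
      proof -
        \<comment> \<open>By parity the pair can meet only traversal \<open>k\<close> and its own
          turning edge.\<close>
        have "2 * k' \<noteq> Suc (2 * k)" "Suc (2 * k') \<noteq> 2 * k"
          by presburger+
        then show ?thesis
          unfolding sub[OF that] i using that e_dir_subset_pivot[of j k] N_pos by auto
      qed
      show ?thesis
      proof (rule *[of "tick k (N - 1)"])
        show "Suc (tick k (N - 1)) < tick K 0"
          unfolding Suc_tick using tick_less[OF i(2)] N_pos by simp
        show "e' (tick k (N - 1)) \<subseteq> S" "e' (Suc (tick k (N - 1))) \<subseteq> S"
          unfolding Suc_tick using sub' N_pos by simp_all
        show "tick k' j = tick k (N - 1) \<or> tick k' j = Suc (tick k (N - 1))"
          if "k' < K" "j \<le> N" "e' (tick k' j) \<subseteq> S" for k' j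
          unfolding Suc_tick \<open>Suc (N - 1) = N\<close> using sub'[OF that(2)] that(3) by auto
      qed
    next
      case False
      then have i: "i = Suc (2 * k)" "Suc k < K"
        using 2 by (auto simp: k_def elim!: oddE)
      have sub': "e' (tick k' j) \<subseteq> S \<longleftrightarrow> k' = k \<and> j = N \<or> k' = Suc k \<and> j = 0" if "j \<le> N" for k' j
      proof -
        \<comment> \<open>By parity the pair meets only the turning edge of block \<open>k\<close>
          and traversal \<open>Suc k\<close>, whose first edge carries the pivot.\<close>
        have "2 * k' \<noteq> Suc (2 * k)" "Suc (2 * k') \<noteq> Suc (Suc (2 * k))"
          "2 * k' = Suc (Suc (2 * k)) \<longleftrightarrow> k' = Suc k"
          by presburger+
        then show ?thesis
          unfolding sub[OF that] i using that e_dir_Suc_subset_pivot[of j k] N_pos by auto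
      qed
      show ?thesis
      proof (rule *[of "tick k N"])
        show "Suc (tick k N) < tick K 0"
          unfolding Suc_tick_N using tick_less[OF i(2)] by simp
        show "e' (tick k N) \<subseteq> S" "e' (Suc (tick k N)) \<subseteq> S"
          unfolding Suc_tick_N using sub' by simp_all
        show "tick k' j = tick k N \<or> tick k' j = Suc (tick k N)"
          if "k' < K" "j \<le> N" "e' (tick k' j) \<subseteq> S" for k' j
          unfolding Suc_tick_N using sub'[OF that(2)] that(3) by auto
      qed
    qed
  qed
qed

lemma e'_inj: "inj_on e' {..<tick K 0}"
proof (rule inj_onI)
  fix s t assume st: "s \<in> {..<tick K 0}" "t \<in> {..<tick K 0}" "e' s = e' t"
  have e_sub: "e (dir k j) \<subseteq> {1..b}" if "j < N" for k j
    using F_sub e_F dir_less that by blast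
  have parity: "2 * k \<noteq> Suc (2 * k')" for k k' :: nat
    by presburger
  have "s < tick K 0" using st by simp
  then show "s = t"
  proof (cases rule: tick_cases)
    case s: (traverse k j)
    have "t < tick K 0" using st by simp
    then show ?thesis
    proof (cases rule: tick_cases)
      case t: (traverse k' j')
      have "k = k'" "e (dir k j) = e (dir k' j')"
        using st(3) s t insert_fresh_eq[OF e_sub e_sub] by (auto simp: e'_traverse)
      then show ?thesis
        using s t inj_onD[OF e_inj] dir_less dir_inj by (metis lessThan_iff)
    next
      case t: (turn k')
      then show ?thesis
        using st(3) s insert_fresh_eq[OF e_sub pivot_sub] parity by (auto simp: e'_traverse e'_turn)
    qed
  next
    case s: (turn k)
    have "t < tick K 0" using st by simp
    then show ?thesis
    proof (cases rule: tick_cases)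
      case t: (traverse k' j')
      then show ?thesis
        using st(3) s insert_fresh_eq[OF pivot_sub e_sub] parity[symmetric] by (auto simp: e'_traverse e'_turn)
    next
      case t: (turn k')
      then show ?thesis
        using st(3) s insert_fresh_eq[OF pivot_sub pivot_sub] by (auto simp: e'_turn)
    qed
  qed
qed

section \<open>Closing the induction on the uniformity\<close>

lemma Q'_faces:
  assumes "S \<in> Q'" "v \<in> S" shows "S - {v} \<in> F'"
proof -
  from assms(1) consider i q where "S = insert (fresh i) q" "i < 2 * K" "even i" "q \<in> Q"
    | i where "S = {fresh i, fresh (Suc i)} \<union> pivot i" "Suc i < 2 * K"
    unfolding Q'_def by blast
  then show ?thesis
  proof cases
    case 1
    show ?thesis
    proof (cases "v = fresh i")
      case True
      then have "S - {v} = q" using 1 by auto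
      then show ?thesis using 1 by (simp add: F'_def)
    next
      case False
      then have "S - {v} = insert (fresh i) (q - {v})" "q - {v} \<in> F"
        using 1 assms(2) Q_faces by auto
      then show ?thesis using 1 F'_iff_one[OF F_sub] by simp
    qed
  next
    case 2
    consider "v = fresh i" | "v = fresh (Suc i)" | "v \<in> pivot i"
      using 2 assms(2) by blast
    then show ?thesis
    proof cases
      case 1
      then have "S - {v} = insert (fresh (Suc i)) (pivot i)" using 2 by auto
      then show ?thesis
        using F'_iff_one[OF pivot_sub, of "Suc i" i] 2 pivot_F pivot_even_Suc by auto
    next
      case v: 2
      then have "S - {v} = insert (fresh i) (pivot i)" using 2 by auto
      then show ?thesis
        using F'_iff_one[OF pivot_sub, of i i] 2 pivot_F by auto
    next
      case 3
      then have "S - {v} = {fresh i, fresh (Suc i)} \<union> (pivot i - {v})"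
        using 2 by (metis Un_Diff Diff_insert0 Diff_empty insert_iff empty_iff fresh_notin_simps(1))
      then show ?thesis
        using 2 3 unfolding F'_def by blast
    qed
  qed
qed

lemma F'_sub_card:
  assumes "f \<in> F'" shows "f \<subseteq> {1..b + 2 * K} \<and> card f = Suc r"
proof -
  have mono: "{1..b} \<subseteq> {1..b + 2 * K}" and fresh: "\<And>i. i < 2 * K \<Longrightarrow> fresh i \<in> {1..b + 2 * K}"
    by (auto simp: fresh_def)
  have fin: "finite g" if "g \<in> F" for g
    using that F_sub finite_subset by blast
  from assms consider i g where "f = insert (fresh i) g" "i < 2 * K" "g \<in> F"
    | "f \<in> Q"
    | i v where "f = {fresh i, fresh (Suc i)} \<union> (pivot i - {v})" "Suc i < 2 * K" "v \<in> pivot i"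
    using pivot_F unfolding F'_def by blast
  then show ?thesis
  proof cases
    case 1
    then show ?thesis
      using F_sub[OF 1(3)] F_card[OF 1(3)] fin fresh mono by auto
  next
    case 2
    then show ?thesis using Q_sub Q_card mono by blast
  next
    case 3
    have "pivot i - {v} \<subseteq> {1..b + 2 * K}"
      using pivot_sub mono by blast
    moreover have "card f = Suc r"
      using 3 pivot_finite[of i] pivot_card[of i] card_Suc_Diff1[of "pivot i" v] by simp
    ultimately show ?thesis using 3 fresh by simp
  qed
qed

lemma Q'_sub_card:
  assumes "S \<in> Q'" shows "S \<subseteq> {1..b + 2 * K} \<and> card S = Suc (Suc r)"
proof -
  have mono: "{1..b} \<subseteq> {1..b + 2 * K}" and fresh: "\<And>i. i < 2 * K \<Longrightarrow> fresh i \<in> {1..b + 2 * K}"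
    by (auto simp: fresh_def)
  from assms consider i q where "S = insert (fresh i) q" "i < 2 * K" "q \<in> Q"
    | i where "S = {fresh i, fresh (Suc i)} \<union> pivot i" "Suc i < 2 * K"
    unfolding Q'_def by blast
  then show ?thesis
  proof cases
    case 1
    have "finite q"
      using Q_sub[OF 1(3)] finite_subset by blast
    then show ?thesis
      using Q_sub[OF 1(3)] Q_card[OF 1(3)] 1 fresh mono by auto
  next
    case 2
    have "pivot i \<subseteq> {1..b + 2 * K}"
      using pivot_sub mono by blast
    then show ?thesis
      using 2 fresh pivot_finite[of i] pivot_card[of i] by simp
  qed
qed

lemma slow_chain_extend: "slow_chain (Suc r) (b + 2 * K) (tick K 0) F' Q' e'"
proof
  show "0 < tick K 0"
    using K_pos by (simp add: tick_def)
qed (use F'_sub_card Q'_sub_card e'_F' e'_inj Q'_faces Q'_link Q'_unique faces_missing' cells_missing'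
      in \<open>simp_all only:\<close>)

end
end

text \<open>Each level adds \<open>2 * K\<close> vertices and turns length \<open>N\<close> into
  \<open>K * Suc N\<close>, which is at least \<open>K * K ^ r\<close>.\<close>

lemma slow_chain_exists:
  assumes "0 < K"
  shows "\<exists>N F Q e. slow_chain r (2 * K * r) N F Q e \<and> K ^ r \<le> N"
proof (induction r)
  case 0
  then show ?case
    using slow_chain_0 by (intro exI[of _ 1] exI conjI) auto
next
  case (Suc r)
  then obtain N F Q e where *: "slow_chain r (2 * K * r) N F Q e" "K ^ r \<le> N"
    by blast
  interpret slow_chain r "2 * K * r" N F Q e by fact
  have "K ^ Suc r \<le> tick K 0"
    using *(2) by (simp add: tick_def trans_le_add2)
  moreover have "2 * K * Suc r = 2 * K * r + 2 * K"
    by simp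
  ultimately show ?case
    using slow_chain_extend[OF assms] by metis
qed

section \<open>The process on a chain\<close>

lemma nsets_Suc_card:
  assumes "card S = Suc r"
  shows "[S]\<^bsup>r\<^esup> = (\<lambda>v. S - {v}) ` S"
proof
  have fin: "finite S"
    using assms card_ge_0_finite by force
  show "[S]\<^bsup>r\<^esup> \<subseteq> (\<lambda>v. S - {v}) ` S"
  proof
    fix f assume f: "f \<in> [S]\<^bsup>r\<^esup>"
    then have "card (S - f) = 1"
      using assms fin by (auto simp: nsets_def card_Diff_subset)
    then obtain v where "S - f = {v}"
      by (auto simp: card_1_singleton_iff)
    then have "v \<in> S" "f = S - {v}"
      using f by (auto simp: nsets_def)
    then show "f \<in> (\<lambda>v. S - {v}) ` S" by blast
  qed
  show "(\<lambda>v. S - {v}) ` S \<subseteq> [S]\<^bsup>r\<^esup>"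
    using fin assms by (auto simp: nsets_def)
qed

text \<open>Only the image of the embedding matters for the edges, and every \<open>k\<close>-subset
  is such an image.\<close>

lemma edges_of_clique_copies:
  "snd ` copies (complete_hypergraph r k) n = {[S]\<^bsup>r\<^esup> | S. S \<subseteq> {1..n} \<and> card S = k}"
proof -
  have img: "(`) f ` ([{1..k}]\<^bsup>r\<^esup>) = [f ` {1..k}]\<^bsup>r\<^esup>" if "inj_on f {1..k}" for f :: "nat \<Rightarrow> nat"
    using bij_betw_nsets[OF inj_on_imp_bij_betw[OF that], of r] by (simp add: bij_betw_def)
  show ?thesis
  proof (intro equalityI subsetI)
    fix E assume "E \<in> snd ` copies (complete_hypergraph r k) n"
    then obtain f where f: "inj_on f {1..k}" "f ` {1..k} \<subseteq> {1..n}" "E = (`) f ` ([{1..k}]\<^bsup>r\<^esup>)"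
      by (auto simp: copies_def complete_hypergraph_def)
    then show "E \<in> {[S]\<^bsup>r\<^esup> | S. S \<subseteq> {1..n} \<and> card S = k}"
      using img[OF f(1)] card_image[OF f(1)] by (intro CollectI exI[of _ "f ` {1..k}"]) simp
  next
    fix E assume "E \<in> {[S]\<^bsup>r\<^esup> | S. S \<subseteq> {1..n} \<and> card S = k}"
    then obtain S where S: "S \<subseteq> {1..n}" "card S = k" "E = [S]\<^bsup>r\<^esup>"
      by blast
    then have "finite S" using finite_subset by blast
    then obtain f where "bij_betw f {1..k} S"
      using finite_same_card_bij[of "{1..k}" S] S by auto
    then have f: "inj_on f {1..k}" "f ` {1..k} = S"
      by (auto simp: bij_betw_def)
    have "(S, E) \<in> copies (complete_hypergraph r k) n"
      unfolding copies_def complete_hypergraph_def fst_conv snd_conv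
      using f S img[OF f(1)] by (intro CollectI exI[of _ f]) simp
    then show "E \<in> snd ` copies (complete_hypergraph r k) n"
      by force
  qed
qed

text \<open>The edges of a copy on \<open>S\<close> are the faces \<open>S - {v}\<close>, so the two
  clauses together make \<open>f\<close> the single missing face of \<open>S\<close>.\<close>

lemma clique_bootstrap_step:
  "bootstrap_step r (complete_hypergraph r (Suc r)) n G =
    G \<union> {f \<in> [{1..n}]\<^bsup>r\<^esup>. \<exists>S \<subseteq> {1..n}. card S = Suc r \<and>
      \<not> (\<forall>v \<in> S. S - {v} \<in> G) \<and> (\<forall>v \<in> S. S - {v} \<in> G \<or> S - {v} = f)}"
proof -
  let ?C = "copies (complete_hypergraph r (Suc r)) n"
  have "(\<exists>H' \<in> ?C. \<not> snd H' \<subseteq> G \<and> snd H' \<subseteq> G \<union> {f}) \<longleftrightarrow>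
    (\<exists>S \<subseteq> {1..n}. card S = Suc r \<and>
      \<not> (\<forall>v \<in> S. S - {v} \<in> G) \<and> (\<forall>v \<in> S. S - {v} \<in> G \<or> S - {v} = f))" (is "?L \<longleftrightarrow> ?R") for f
  proof -
    have "?L \<longleftrightarrow> (\<exists>E \<in> snd ` ?C. \<not> E \<subseteq> G \<and> E \<subseteq> G \<union> {f})"
      by (simp only: bex_simps)
    also have "\<dots> \<longleftrightarrow> (\<exists>S \<subseteq> {1..n}. card S = Suc r \<and> \<not> [S]\<^bsup>r\<^esup> \<subseteq> G \<and> [S]\<^bsup>r\<^esup> \<subseteq> G \<union> {f})"
      unfolding edges_of_clique_copies by blast
    also have "\<dots> \<longleftrightarrow> ?R"
      by (intro ex_cong1 conj_cong refl) (auto simp: nsets_Suc_card)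
    finally show ?thesis .
  qed
  then show ?thesis
    unfolding bootstrap_step_def by simp
qed

section \<open>One-by-one infection along the chain\<close>

context slow_chain
begin

text \<open>\<open>stage 0\<close> serves as the starting hypergraph: all of \<open>F\<close>
  outside the chain, and the seed \<open>e 0\<close> that sets the chain off.\<close>

definition stage :: "nat \<Rightarrow> nat set set" where
  "stage t = (F - e ` {..<N}) \<union> e ` {..t}"

lemma e_in_stage:
  assumes "s < N" "t < N" shows "e s \<in> stage t \<longleftrightarrow> s \<le> t"
  using assms inj_on_eq_iff[OF e_inj] by (fastforce simp: stage_def)

lemma stage_sub: "t < N \<Longrightarrow> stage t \<subseteq> F"
  using e_F by (auto simp: stage_def)

text \<open>Here \<open>3 \<le> r\<close> enters: \<open>faces_missing\<close> gives
  \<open>r - 1\<close> missing faces, hence at least two. A vertex outside \<open>{1..b}\<close>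
  spoils every face that retains it.\<close>

lemma two_faces_missing:
  assumes "3 \<le> r" "finite S" "card S = Suc r" "S \<notin> Q"
  obtains v w where "v \<in> S" "w \<in> S" "v \<noteq> w" "S - {v} \<notin> F" "S - {w} \<notin> F"
proof -
  let ?M = "{v \<in> S. S - {v} \<notin> F}"
  have "2 \<le> card ?M"
  proof (cases "S \<subseteq> {1..b}")
    case True
    then show ?thesis
      using faces_missing[of S] assms by simp
  next
    case False
    then obtain x where x: "x \<in> S" "x \<notin> {1..b}" by blast
    have "S - {v} \<notin> F" if "v \<in> S - {x}" for v
      using F_sub[of "S - {v}"] x that by blast
    then have "S - {x} \<subseteq> ?M" by blast
    then have "card (S - {x}) \<le> card ?M"
      using assms(2) by (intro card_mono) auto
    then show ?thesis using assms x by simp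
  qed
  then obtain T where "T \<subseteq> ?M" "card T = 2"
    by (meson obtain_subset_with_card_n)
  then show thesis
    using that by (auto simp: card_2_iff)
qed

text \<open>By \<open>two_faces_missing\<close> a set outside \<open>Q\<close> never fires. A clique
  of \<open>Q\<close> has exactly two chain faces, \<open>e s\<close> and \<open>e (Suc s)\<close>,
  and its other faces are infected from the start; it fires only if exactly one of the two is
  healthy, which at \<open>stage t\<close> means \<open>s = t\<close>.\<close>

lemma step_stage:
  assumes "3 \<le> r" "b \<le> n" "Suc t < N"
  shows "bootstrap_step r (complete_hypergraph r (Suc r)) n (stage t) = stage (Suc t)"
proof -
  have Suc_stage: "stage (Suc t) = insert (e (Suc t)) (stage t)"
    by (auto simp: stage_def atMost_Suc)
  have tN: "t < N" using assms by simp
  have only: "f = e (Suc t)"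
    if f: "S \<subseteq> {1..n}" "card S = Suc r" "\<not> (\<forall>v \<in> S. S - {v} \<in> stage t)"
      "\<forall>v \<in> S. S - {v} \<in> stage t \<or> S - {v} = f" for f S
  proof -
    have fin: "finite S" using f(1) finite_subset by blast
    have "S \<in> Q"
    proof (rule ccontr)
      assume "S \<notin> Q"
      then obtain v w where vw: "v \<in> S" "w \<in> S" "v \<noteq> w" "S - {v} \<notin> F" "S - {w} \<notin> F"
        using two_faces_missing[OF assms(1) fin f(2)] by blast
      then have "S - {v} = f" "S - {w} = f"
        using f(4) stage_sub[OF tN] by blast+
      then show False using vw by blast
    qed
    then obtain s where s: "Suc s < N" "{i. i < N \<and> e i \<subseteq> S} = {s, Suc s}"
      using Q_unique by blast
    obtain v where v: "v \<in> S" "S - {v} \<notin> stage t"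
      using f(3) by blast
    then have f_eq: "f = S - {v}" using f(4) by blast
    have "S - {v} \<in> F" using Q_faces \<open>S \<in> Q\<close> v by blast
    then obtain i where i: "i < N" "f = e i"
      using v f_eq by (auto simp: stage_def)
    then have "i \<in> {s, Suc s}"
      using s(2) f_eq by blast
    \<comment> \<open>\<open>f\<close> is the only missing face, so the other chain face of
      \<open>S\<close> is infected.\<close>
    have in_stage: "e j \<in> stage t" if "j \<in> {s, Suc s}" "j \<noteq> i" for j
    proof -
      have j: "j < N" "e j \<subseteq> S" using that s(2) by blast+
      then have "e j \<in> [S]\<^bsup>r\<^esup>"
        using F_card[OF e_F] fin finite_subset by (auto simp: nsets_def)
      then obtain w where "w \<in> S" "e j = S - {w}"
        using nsets_Suc_card[OF f(2)] by blast
      moreover have "e j \<noteq> f"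
        using inj_on_eq_iff[OF e_inj] j i that by auto
      ultimately show ?thesis using f(4) by metis
    qed
    have "\<not> i \<le> t"
      using e_in_stage[OF i(1) tN] v f_eq i by simp
    \<comment> \<open>Infected chain edges form an initial segment, so \<open>e (Suc s)\<close>
      cannot be infected before \<open>e s\<close>.\<close>
    moreover have "i = Suc s"
    proof (rule ccontr)
      assume "i \<noteq> Suc s"
      then have "i = s" "Suc s \<le> t"
        using \<open>i \<in> {s, Suc s}\<close> in_stage[of "Suc s"] e_in_stage[OF s(1) tN] by auto
      then show False using \<open>\<not> i \<le> t\<close> by simp
    qed
    moreover have "s \<le> t"
      using in_stage[of s] e_in_stage[of s t] tN s(1) \<open>i = Suc s\<close> by simp
    ultimately have "i = Suc t" by simp
    then show ?thesis using i by simp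
  qed
  have edge: "e (Suc t) \<in> [{1..n}]\<^bsup>r\<^esup>"
    using F_sub[OF e_F[OF assms(3)]] F_card[OF e_F[OF assms(3)]] assms(2) finite_subset
    by (fastforce simp: nsets_def)
  have clique: "\<exists>S \<subseteq> {1..n}. card S = Suc r \<and> \<not> (\<forall>v \<in> S. S - {v} \<in> stage t) \<and>
      (\<forall>v \<in> S. S - {v} \<in> stage t \<or> S - {v} = e (Suc t))"
  proof (intro exI conjI)
    let ?S = "e t \<union> e (Suc t)"
    have Q: "?S \<in> Q" using Q_link assms by simp
    show "?S \<subseteq> {1..n}" using Q_sub[OF Q] assms(2) by fastforce
    then have fin: "finite ?S" using finite_subset by blast
    show card: "card ?S = Suc r" using Q_card[OF Q] .
    have "e (Suc t) \<in> [?S]\<^bsup>r\<^esup>"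
      using F_card[OF e_F[OF assms(3)]] fin by (auto simp: nsets_def)
    then obtain w where "w \<in> ?S" "e (Suc t) = ?S - {w}"
      unfolding nsets_Suc_card[OF card] by blast
    moreover have "e (Suc t) \<notin> stage t"
      using e_in_stage[OF assms(3) tN] by simp
    ultimately show "\<not> (\<forall>v \<in> ?S. ?S - {v} \<in> stage t)" by metis
    obtain s where s: "Suc s < N" "{i. i < N \<and> e i \<subseteq> ?S} = {s, Suc s}"
      using Q_unique[OF Q] by blast
    have "t \<in> {s, Suc s}" "Suc t \<in> {s, Suc s}"
      using s(2) assms(3) tN by blast+
    \<comment> \<open>Hence \<open>e t\<close> and \<open>e (Suc t)\<close> are the only chain faces
      of this clique.\<close>
    then have "s = t" by auto
    show "\<forall>v \<in> ?S. ?S - {v} \<in> stage t \<or> ?S - {v} = e (Suc t)"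
    proof
      fix v assume "v \<in> ?S"
      then have "?S - {v} \<in> F" using Q_faces[OF Q] by blast
      show "?S - {v} \<in> stage t \<or> ?S - {v} = e (Suc t)"
      proof (cases "?S - {v} \<in> e ` {..<N}")
        case True
        then obtain i where i: "i < N" "?S - {v} = e i" by auto
        then have "i \<in> {s, Suc s}" using s(2) by blast
        then show ?thesis
          using i e_in_stage[OF tN tN] \<open>s = t\<close> by auto
      next
        case False
        then show ?thesis using \<open>?S - {v} \<in> F\<close> by (simp add: stage_def)
      qed
    qed
  qed
  have "{f \<in> [{1..n}]\<^bsup>r\<^esup>. \<exists>S \<subseteq> {1..n}. card S = Suc r \<and> \<not> (\<forall>v \<in> S. S - {v} \<in> stage t) \<and>
      (\<forall>v \<in> S. S - {v} \<in> stage t \<or> S - {v} = f)} = {e (Suc t)}" (is "?A = _")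
  proof (intro equalityI subsetI)
    fix f assume "f \<in> ?A"
    then have "f = e (Suc t)"
      by (elim CollectE conjE exE) (rule only)
    then show "f \<in> {e (Suc t)}" by simp
  next
    fix f assume "f \<in> {e (Suc t)}"
    then have "f = e (Suc t)" by simp
    show "f \<in> ?A"
      unfolding \<open>f = e (Suc t)\<close> by (intro CollectI conjI edge clique)
  qed
  then show ?thesis
    unfolding clique_bootstrap_step Suc_stage by simp
qed

lemma process_stage:
  assumes "3 \<le> r" "b \<le> n" "t < N"
  shows "bootstrap_process r (complete_hypergraph r (Suc r)) n (stage 0) t = stage t"
  using assms(3)
proof (induction t)
  case 0
  then show ?case by (simp add: bootstrap_process_def)
next
  case (Suc t)
  then show ?case
    using step_stage[OF assms(1,2) Suc.prems] by (simp add: bootstrap_process_def)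
qed

end

section \<open>Bounds on the running time\<close>

text \<open>Until it stabilises the process gains an edge per step, and there is room for only
  \<open>n choose r\<close> edges.\<close>

lemma process_stabilises:
  assumes "G \<subseteq> [{1..n}]\<^bsup>r\<^esup>"
  shows "\<exists>t \<le> n choose r. bootstrap_process r H n G t = bootstrap_process r H n G (t + 1)"
proof (rule ccontr)
  let ?P = "bootstrap_process r H n G"
  assume neg: "\<not> ?thesis"
  have fin: "finite ([{1..n}]\<^bsup>r\<^esup>)"
    by (simp add: finite_imp_finite_nsets)
  have sub: "?P t \<subseteq> [{1..n}]\<^bsup>r\<^esup>" for t
    by (induction t) (use assms in \<open>auto simp: bootstrap_process_def bootstrap_step_def\<close>)
  have "?P t \<subseteq> ?P (t + 1)" for t
    by (auto simp: bootstrap_process_def bootstrap_step_def)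
  then have less: "card (?P t) < card (?P (t + 1))" if "t \<le> n choose r" for t
    using neg that sub[of "t + 1"] fin by (metis finite_subset psubsetI psubset_card_mono)
  \<comment> \<open>The range reaches one past the number of available edges, which gives the
    contradiction.\<close>
  have "t \<le> card (?P t)" if "t \<le> Suc (n choose r)" for t
    using that
  proof (induction t)
    case (Suc t)
    then show ?case using less[of t] by simp
  qed simp
  from this[of "Suc (n choose r)"] have "Suc (n choose r) \<le> card ([{1..n}]\<^bsup>r\<^esup>)"
    using card_mono[OF fin sub] by (meson order_refl order_trans)
  then show False by simp
qed

lemma running_time_le:
  assumes "G \<subseteq> [{1..n}]\<^bsup>r\<^esup>"
  shows "running_time r H n G \<le> n choose r"
proof -
  obtain t where "t \<le> n choose r" "bootstrap_process r H n G t = bootstrap_process r H n G (t + 1)"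
    using process_stabilises[OF assms] by blast
  then show ?thesis
    unfolding running_time_def by (meson Least_le order_trans)
qed

text \<open>Stabilisation ensures that the \<open>LEAST\<close> is attained, so
  \<open>running_time\<close> is itself a time of equality and cannot lie below
  \<open>T\<close>.\<close>

lemma running_time_ge:
  assumes "G \<subseteq> [{1..n}]\<^bsup>r\<^esup>"
    and "\<And>t. t < T \<Longrightarrow> bootstrap_process r H n G t \<noteq> bootstrap_process r H n G (t + 1)"
  shows "T \<le> running_time r H n G"
proof -
  obtain t where "bootstrap_process r H n G t = bootstrap_process r H n G (t + 1)"
    using process_stabilises[OF assms(1)] by blast
  then have "bootstrap_process r H n G (running_time r H n G) =
      bootstrap_process r H n G (running_time r H n G + 1)"
    unfolding running_time_def by (rule LeastI)
  then show ?thesis using assms(2) not_le by blast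
qed

lemma finite_running_times: "finite (running_time r H n ` Pow ([{1..n}]\<^bsup>r\<^esup>))"
  by (simp add: finite_imp_finite_nsets)

lemma max_running_time_le: "max_running_time r H n \<le> n choose r"
  unfolding max_running_time_def
  by (rule Max.boundedI[OF finite_running_times]) (auto simp del: One_nat_def intro: running_time_le)

lemma max_running_time_ge: "G \<subseteq> [{1..n}]\<^bsup>r\<^esup> \<Longrightarrow> running_time r H n G \<le> max_running_time r H n"
  unfolding max_running_time_def by (rule Max_ge[OF finite_running_times]) blast

section \<open>The bounds of order \<open>n ^ r\<close>\<close>

lemma clique_running_time_ge:
  assumes "3 \<le> r" "0 < K" "2 * K * r \<le> n"
  shows "K ^ r - 1 \<le> clique_running_time r (r + 1) n"
proof -
  obtain N F Q e where *: "slow_chain r (2 * K * r) N F Q e" "K ^ r \<le> N"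
    using slow_chain_exists[OF assms(2), of r] by blast
  interpret slow_chain r "2 * K * r" N F Q e by fact
  have "f \<in> [{1..n}]\<^bsup>r\<^esup>" if "f \<in> F" for f
  proof -
    have "{1..2 * K * r} \<subseteq> {1..n}" using assms(3) by simp
    then have "f \<subseteq> {1..n}" using F_sub[OF that] by (rule order_trans[rotated])
    then show ?thesis
      using F_card[OF that] finite_subset[of f "{1..n}"] by (simp add: nsets_def)
  qed
  then have G: "stage 0 \<subseteq> [{1..n}]\<^bsup>r\<^esup>"
    using stage_sub[OF N_pos] by blast
  have "stage t \<noteq> stage (Suc t)" if "Suc t < N" for t
    using e_in_stage[of "Suc t" t] e_in_stage[of "Suc t" "Suc t"] that by auto
  \<comment> \<open>\<open>e 0\<close> is present from the start, so \<open>N\<close> chain edges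
    account for \<open>N - 1\<close> proper steps.\<close>
  then have "N - 1 \<le> running_time r (complete_hypergraph r (r + 1)) n (stage 0)"
    using process_stage[OF assms(1,3)] by (intro running_time_ge[OF G]) simp
  also have "\<dots> \<le> clique_running_time r (r + 1) n"
    unfolding clique_running_time_def by (rule max_running_time_ge[OF G])
  finally show ?thesis using *(2) by linarith
qed

text \<open>\<open>K\<close> is the largest value for which the \<open>2 * K * r\<close> chain
  vertices fit into \<open>n\<close>. Rounding costs a factor of at most two in \<open>n\<close>,
  and another factor of two absorbs the \<open>- 1\<close>.\<close>

lemma clique_running_time_ge_real:
  assumes "3 \<le> r" "4 * r \<le> n"
  shows "real n ^ r \<le> 2 * (4 * real r) ^ r * real (clique_running_time r (r + 1) n)"
proof -
  define K where "K = n div (2 * r)"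
  \<comment> \<open>\<open>4 * r \<le> n\<close> makes \<open>K\<close> at least two, which secures
    both \<open>Suc K \<le> 2 * K\<close> and \<open>2 \<le> K ^ r\<close>.\<close>
  have "4 * r div (2 * r) \<le> K"
    unfolding K_def using assms(2) by (rule div_le_mono)
  then have K: "2 \<le> K"
    using assms(1) by simp
  have "2 * K * r \<le> n"
    using times_div_less_eq_dividend[of "2 * r" n] by (simp only: K_def ac_simps)
  then have time: "K ^ r - 1 \<le> clique_running_time r (r + 1) n"
    using clique_running_time_ge[OF assms(1)] K by simp
  have "n < Suc K * (2 * r)"
    using dividend_less_div_times[of "2 * r" n] assms(1) by (simp add: K_def)
  also have "\<dots> \<le> 2 * K * (2 * r)"
    using K by (intro mult_le_mono1) simp
  finally have "n \<le> 4 * r * K"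
    by (simp add: ac_simps)
  then have "n ^ r \<le> (4 * r) ^ r * K ^ r"
    by (metis power_mono power_mult_distrib zero_le)
  also have "K ^ r \<le> 2 * (K ^ r - 1)"
  proof -
    have "2 ^ 1 \<le> K ^ r"
      using K assms(1) by (intro order_trans[OF power_increasing[of 1 r 2] power_mono]) auto
    then show ?thesis by simp
  qed
  also have "\<dots> \<le> 2 * clique_running_time r (r + 1) n"
    using time by simp
  finally have "n ^ r \<le> (4 * r) ^ r * (2 * clique_running_time r (r + 1) n)"
    by simp
  then have "real (n ^ r) \<le> real ((4 * r) ^ r * (2 * clique_running_time r (r + 1) n))"
    by (simp only: of_nat_le_iff)
  then show ?thesis by (simp add: ac_simps)
qed

theorem theorem1p3:
  fixes r :: nat
  assumes "r \<ge> 3"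
  shows "(\<lambda>n::nat. real (clique_running_time r (r + 1) n)) \<in> \<Theta>(\<lambda>n. real n ^ r)"
proof
  have "clique_running_time r (r + 1) n \<le> n ^ r" for n
  proof -
    have "clique_running_time r (r + 1) n \<le> n choose r"
      unfolding clique_running_time_def by (rule max_running_time_le)
    also have "\<dots> \<le> n ^ r"
      by (cases "r \<le> n") (auto simp: binomial_le_pow binomial_eq_0)
    finally show ?thesis .
  qed
  then show "(\<lambda>n::nat. real (clique_running_time r (r + 1) n)) \<in> O(\<lambda>n. real n ^ r)"
    by (intro landau_o.bigI[of 1]) (simp_all flip: of_nat_power)
  show "(\<lambda>n::nat. real (clique_running_time r (r + 1) n)) \<in> \<Omega>(\<lambda>n. real n ^ r)"
    \<comment> \<open>Swapping the two sides gives a big-O claim with the constant of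
      \<open>clique_running_time_ge_real\<close>, valid from \<open>4 * r\<close> on.\<close>
    unfolding bigomega_iff_bigo
  proof (rule landau_o.bigI)
    show "0 < 2 * (4 * real r) ^ r" using assms by simp
    show "\<forall>\<^sub>F n in sequentially. norm (real n ^ r) \<le>
        2 * (4 * real r) ^ r * norm (real (clique_running_time r (r + 1) n))"
      using eventually_ge_at_top[of "4 * r"]
      by eventually_elim (use clique_running_time_ge_real[OF assms] in simp)
  qed
qed

end
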